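(* Every infinite prime poset with no infinite antichain embeds a member of $\mathcal L=\{P_1,P_1^*,P_2,P_2^*\}$.
   Context: For a poset $P=(V,\le)$, $P^*$ denotes its dual (same set, reversed order). A subset $A\subseteq V$ is autonomous in $P$ if for all $v\in V\setminus A$ and all $a,a'\in A$: $v<a$ implies $v<a'$, and $a<v$ implies $a'<v$. The empty set, the singletons and $V$ are the trivial autonomous sets. $P$ is prime if it has more than three elements and all its autonomous sets are trivial. A poset $P$ embeds a poset $P'$ if $P'$ is isomorphic to an induced subposet of $P$. Let $G_1$ be the bipartite graph with vertex set $\{a_i: i\in\mathbb N\}\cup\{b_i: i\in\mathbb N\}$ (all distinct) whose edges are the pairs $\{a_i,b_j\}$ with $i\le j$, and let $G_2$ be the one-way infinite path, with vertices $v_0,v_1,v_2,\dots$ and edges $\{v_n,v_{n+1}\}$. $P_1$ and $P_1^*$ are the two transitive orientations of the complement of $G_1$, and $P_2$ and $P_2^*$ are the two transitive orientations of the complement of $G_2$ (a transitive orientation of a graph is a partial order on its vertex set whose pairs of distinct comparable elements are exactly the edges). Explicitly, up to exchanging a poset with its dual: in $P_1$, $a_i<a_j$ iff $i>j$, $b_i<b_j$ iff $i>j$, $a_i<b_j$ iff $i>j$, and there are no other strict comparabilities; in $P_2$, $v_m<v_n$ iff $n\ge m+2$. *)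

theory Defs
  imports Main
begin

text \<open>
  A poset is a carrier \<open>V\<close> together with its reflexive order \<open>r\<close>, subject to
  \<open>partial_order_on V r\<close>; \<open>(x, y) \<in> r\<close> means \<open>x \<le> y\<close>.  The dual poset is \<open>r\<inverse>\<close>
  on the same carrier.
\<close>

definition slt :: "'a rel \<Rightarrow> 'a \<Rightarrow> 'a \<Rightarrow> bool" where
  "slt r x y \<longleftrightarrow> (x, y) \<in> r \<and> x \<noteq> y"

definition autonomous :: "'a set \<Rightarrow> 'a rel \<Rightarrow> 'a set \<Rightarrow> bool" where
  "autonomous V r A \<longleftrightarrow> A \<subseteq> V \<and>
     (\<forall>v \<in> V - A. \<forall>a \<in> A. \<forall>a' \<in> A.
        (slt r v a \<longrightarrow> slt r v a') \<and> (slt r a v \<longrightarrow> slt r a' v))"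

definition trivial_subset :: "'a set \<Rightarrow> 'a set \<Rightarrow> bool" where
  "trivial_subset V A \<longleftrightarrow> A = {} \<or> (\<exists>x \<in> V. A = {x}) \<or> A = V"

definition prime_poset :: "'a set \<Rightarrow> 'a rel \<Rightarrow> bool" where
  "prime_poset V r \<longleftrightarrow> partial_order_on V r \<and>
     (infinite V \<or> card V > 3) \<and>
     (\<forall>A. autonomous V r A \<longrightarrow> trivial_subset V A)"

definition antichain_in :: "'a set \<Rightarrow> 'a rel \<Rightarrow> 'a set \<Rightarrow> bool" where
  "antichain_in V r A \<longleftrightarrow> A \<subseteq> V \<and>
     (\<forall>x \<in> A. \<forall>y \<in> A. x \<noteq> y \<longrightarrow> (x, y) \<notin> r \<and> (y, x) \<notin> r)"

definition poset_isomorphic :: "'a set \<Rightarrow> 'a rel \<Rightarrow> 'b set \<Rightarrow> 'b rel \<Rightarrow> bool" where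
  "poset_isomorphic V r V' r' \<longleftrightarrow>
     (\<exists>f. bij_betw f V V' \<and> (\<forall>x \<in> V. \<forall>y \<in> V. (x, y) \<in> r \<longleftrightarrow> (f x, f y) \<in> r'))"

definition embeds_poset :: "'a set \<Rightarrow> 'a rel \<Rightarrow> 'b set \<Rightarrow> 'b rel \<Rightarrow> bool" where
  "embeds_poset V r V' r' \<longleftrightarrow>
     (\<exists>W \<subseteq> V. poset_isomorphic V' r' W (r \<inter> W \<times> W))"

text \<open>Graphs are given by a symmetric irreflexive adjacency relation on a whole type.\<close>

definition complement_graph :: "('a \<Rightarrow> 'a \<Rightarrow> bool) \<Rightarrow> 'a \<Rightarrow> 'a \<Rightarrow> bool" where
  "complement_graph E x y \<longleftrightarrow> x \<noteq> y \<and> \<not> E x y"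

definition transitive_orientation :: "('a \<Rightarrow> 'a \<Rightarrow> bool) \<Rightarrow> 'a rel \<Rightarrow> bool" where
  "transitive_orientation E r \<longleftrightarrow> partial_order_on UNIV r \<and>
     (\<forall>x y. E x y \<longleftrightarrow> x \<noteq> y \<and> ((x, y) \<in> r \<or> (y, x) \<in> r))"

datatype vertex = VA nat | VB nat

fun G1 :: "vertex \<Rightarrow> vertex \<Rightarrow> bool" where
  "G1 (VA i) (VB j) \<longleftrightarrow> i \<le> j"
| "G1 (VB j) (VA i) \<longleftrightarrow> i \<le> j"
| "G1 _ _ \<longleftrightarrow> False"

definition G2 :: "nat \<Rightarrow> nat \<Rightarrow> bool" where
  "G2 m n \<longleftrightarrow> n = Suc m \<or> m = Suc n"

fun P1_less :: "vertex \<Rightarrow> vertex \<Rightarrow> bool" where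
  "P1_less (VA i) (VA j) \<longleftrightarrow> i > j"
| "P1_less (VB i) (VB j) \<longleftrightarrow> i > j"
| "P1_less (VA i) (VB j) \<longleftrightarrow> i > j"
| "P1_less (VB i) (VA j) \<longleftrightarrow> False"

definition P1 :: "vertex rel" where
  "P1 = {(x, y). x = y \<or> P1_less x y}"

definition P2 :: "nat rel" where
  "P2 = {(m, n). m = n \<or> m + 2 \<le> n}"

lemma P1_less_trans: "P1_less x y \<Longrightarrow> P1_less y z \<Longrightarrow> P1_less x z"
  by (cases x; cases y; cases z) auto

lemma P1_less_asym: "P1_less x y \<Longrightarrow> \<not> P1_less y x"
  by (cases x; cases y) auto

lemma partial_order_P1: "partial_order_on UNIV P1"
  using P1_less_trans P1_less_asym
  unfolding partial_order_on_def preorder_on_def refl_on_def trans_def antisym_def P1_def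
  by blast

lemma partial_order_P2: "partial_order_on UNIV P2"
  unfolding partial_order_on_def preorder_on_def refl_on_def trans_def antisym_def P2_def
  by auto

lemma transitive_orientation_converse:
  "transitive_orientation E (r\<inverse>) \<longleftrightarrow> transitive_orientation E r"
  unfolding transitive_orientation_def by auto

lemma transitive_orientation_P1: "transitive_orientation (complement_graph G1) P1"
proof -
  have "complement_graph G1 x y \<longleftrightarrow> x \<noteq> y \<and> ((x, y) \<in> P1 \<or> (y, x) \<in> P1)" for x y
    by (cases x; cases y) (auto simp: complement_graph_def P1_def)
  then show ?thesis
    using partial_order_P1 unfolding transitive_orientation_def by blast
qed

lemma transitive_orientation_P2: "transitive_orientation (complement_graph G2) P2"
  unfolding transitive_orientation_def complement_graph_def G2_def
  using partial_order_P2 by (auto simp: P2_def)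

lemma transitive_orientation_step:
  assumes "transitive_orientation E r" "E x z" "\<not> E y z" "y \<noteq> z"
  shows "(x, y) \<in> r \<Longrightarrow> x \<noteq> y \<Longrightarrow> (x, z) \<in> r"
    and "(y, x) \<in> r \<Longrightarrow> x \<noteq> y \<Longrightarrow> (z, x) \<in> r"
  using assms
  unfolding transitive_orientation_def partial_order_on_def preorder_on_def trans_def
  by blast+

lemma transitive_orientation_unique:
  assumes r: "transitive_orientation E r" and s: "transitive_orientation E s"
    and sub: "\<And>x y. (x, y) \<in> s \<Longrightarrow> x \<noteq> y \<Longrightarrow> (x, y) \<in> r"
  shows "r = s"
proof -
  have refl: "(x, x) \<in> r" "(x, x) \<in> s" for x
    using r s unfolding transitive_orientation_def partial_order_on_def preorder_on_def refl_on_def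
    by blast+
  have "(x, y) \<in> r \<longleftrightarrow> (x, y) \<in> s" for x y
    using refl sub r s unfolding transitive_orientation_def partial_order_on_def antisym_def
    by metis
  then show ?thesis by auto
qed

lemma P2_forced:
  assumes r: "transitive_orientation (complement_graph G2) r" and "(0, 2) \<in> r"
  shows "r = P2"
proof -
  let ?E = "complement_graph G2"
  have E: "?E m n \<longleftrightarrow> m \<noteq> n \<and> n \<noteq> Suc m \<and> m \<noteq> Suc n" for m n
    by (auto simp: complement_graph_def G2_def)
  have right: "(m, m + 2 + k) \<in> r" if "(m, m + 2) \<in> r" for m k
  proof (induction k)
    case (Suc k)
    show ?case
      by (rule transitive_orientation_step(1)[OF r _ _ _ Suc]) (auto simp: E)
  qed (use that in simp)
  have "(m, m + 2) \<in> r" for m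
  proof (induction m)
    case (Suc m)
    have "(m, m + 3) \<in> r" using right[OF Suc, of 1] by (simp add: numeral_eq_Suc)
    then have "(Suc m, m + 3) \<in> r"
      by (rule transitive_orientation_step(2)[OF r, rotated -2]) (auto simp: E)
    then show ?case by (simp add: numeral_eq_Suc)
  qed (use assms in \<open>simp add: numeral_eq_Suc\<close>)
  then have "(m, n) \<in> r" if "m + 2 \<le> n" for m n
    using right that le_Suc_ex by metis
  then show ?thesis
    by (intro transitive_orientation_unique[OF r transitive_orientation_P2]) (auto simp: P2_def)
qed

lemma P1_forced:
  assumes r: "transitive_orientation (complement_graph G1) r" and start: "(VA 1, VB 0) \<in> r"
  shows "r = P1"
proof -
  let ?E = "complement_graph G1"
  note step = transitive_orientation_step[OF r]
  have bb: "(VB k, VB j) \<in> r" if "(VA i, VB j) \<in> r" "j < i" "i \<le> k" for i j k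
    by (rule step(2)[OF _ _ _ that(1)]) (use that in \<open>auto simp: complement_graph_def\<close>)
  have ab: "(VA i, VB j) \<in> r" if "(VB k, VB j) \<in> r" "j < i" "i \<le> k" for i j k
    by (rule step(2)[OF _ _ _ that(1)]) (use that in \<open>auto simp: complement_graph_def\<close>)
  have aa: "(VA i, VA k) \<in> r" if "(VA i, VB j) \<in> r" "j < i" "k \<le> j" for i j k
    by (rule step(1)[OF _ _ _ that(1)]) (use that in \<open>auto simp: complement_graph_def\<close>)
  have ab': "(VA i, VB j) \<in> r" if "(VA i, VA k) \<in> r" "j < i" "k \<le> j" for i j k
    by (rule step(1)[OF _ _ _ that(1)]) (use that in \<open>auto simp: complement_graph_def\<close>)
  have bb0: "(VB k, VB 0) \<in> r" if "0 < k" for k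
    using bb[OF start, of k] that by simp
  have ab0: "(VA i, VB 0) \<in> r" if "0 < i" for i
    using ab[OF bb0, of i i] that by simp
  have a: "(VA i, VB j) \<in> r" if "j < i" for i j
    using ab'[OF aa[OF ab0], of i 0 j] that by simp
  have "(x, y) \<in> r" if "P1_less x y" for x y
    using that a bb aa by (cases x; cases y) auto
  then show ?thesis
    by (intro transitive_orientation_unique[OF r transitive_orientation_P1]) (auto simp: P1_def)
qed

theorem transitive_orientations_G1:
  "transitive_orientation (complement_graph G1) r \<longleftrightarrow> r = P1 \<or> r = P1\<inverse>"
proof
  assume r: "transitive_orientation (complement_graph G1) r"
  have "complement_graph G1 (VA 1) (VB 0)" by (simp add: complement_graph_def)
  then have "(VA 1, VB 0) \<in> r \<or> (VA 1, VB 0) \<in> r\<inverse>"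
    using r unfolding transitive_orientation_def by auto
  then show "r = P1 \<or> r = P1\<inverse>"
    using P1_forced r transitive_orientation_converse converse_converse by metis
qed (use transitive_orientation_P1 transitive_orientation_converse in auto)

theorem transitive_orientations_G2:
  "transitive_orientation (complement_graph G2) r \<longleftrightarrow> r = P2 \<or> r = P2\<inverse>"
proof
  assume r: "transitive_orientation (complement_graph G2) r"
  have "complement_graph G2 0 2" by (simp add: complement_graph_def G2_def)
  then have "(0, 2) \<in> r \<or> (0, 2) \<in> r\<inverse>"
    using r unfolding transitive_orientation_def by auto
  then show "r = P2 \<or> r = P2\<inverse>"
    using P2_forced r transitive_orientation_converse converse_converse by metis
qed (use transitive_orientation_P2 transitive_orientation_converse in auto)

end

theory Submission
  imports Defs "HOL-Library.Ramsey"
begin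

text \<open>
  By Ramsey's theorem and duality there is a strictly decreasing sequence \<open>c\<close>.  Let \<open>U\<close> be
  its up-closure and consider the incomparability graph on \<open>U\<close>.

  If no tail of \<open>c\<close> lies in one connected component, then the components below \<open>c\<^sub>k\<close> form a
  subset of \<open>U\<close> that is split, by primality, only by elements outside \<open>U\<close>; each such element lies
  below some \<open>c\<^sub>m\<close> but not below all of them, with \<open>m\<close> arbitrarily large, and this yields \<open>P\<^sub>1\<close>.

  Otherwise, either some \<open>u \<in> U\<close> has neighbours in \<open>U\<close> that lie above no common \<open>c\<^sub>m\<close>, which again
  yields \<open>P\<^sub>1\<close>, or one joins \<open>c\<^sub>j\<close> to \<open>c\<^bsub>j+1\<^esub>\<close> by a finite path avoiding the elements above \<open>c\<^sub>j\<close>.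
  The union of these paths is an infinite, connected and locally finite graph, so it contains a
  geodesic ray, that is, an induced infinite path, and \<open>P\<^sub>2\<close> or its dual embeds.
\<close>

section \<open>Locally finite graphs and finite connected pieces\<close>

text \<open>Koenig's lemma along shortest paths from \<open>z\<close>: if infinitely many vertices
  lie beyond \<open>x\<close>, then infinitely many lie beyond one of its finitely many
  out-neighbours in the next distance layer. As \<open>E\<close> may be directed, only forward
  shortcuts are excluded; for symmetric \<open>E\<close> the ray is an induced path.\<close>

lemma geodesic_ray:
  assumes fin: "\<And>x. finite (E `` {x})" and inf: "infinite (E\<^sup>* `` {z})"
  obtains f :: "nat \<Rightarrow> 'a"
  where "\<And>n. (f n, f (Suc n)) \<in> E"
    and "\<And>m n. (f m, f n) \<in> E \<Longrightarrow> n \<le> Suc m"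
    and "inj f"
proof -
  \<comment> \<open>Distance from \<open>z\<close>; unspecified for vertices that \<open>z\<close>
    does not reach.\<close>
  define d where "d x = (LEAST n. (z, x) \<in> E ^^ n)" for x
  have d_le: "d x \<le> n" if "(z, x) \<in> E ^^ n" for x n
    unfolding d_def using that by (rule Least_le)
  have d_path: "(z, x) \<in> E ^^ d x" if "(z, x) \<in> E\<^sup>*" for x
    unfolding d_def using rtrancl_imp_relpow[OF that]
    by (rule LeastI_ex[where P = "\<lambda>n. (z, x) \<in> E ^^ n"])
  have d_relpow: "d y \<le> d x + k" if "(z, x) \<in> E\<^sup>*" "(x, y) \<in> E ^^ k" for x y k
    using d_path[OF that(1)] that(2) by (intro d_le) (auto simp: relpow_add)
  \<comment> \<open>For reachable \<open>x\<close>, these are the vertices having a shortest path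
    from \<open>z\<close> through \<open>x\<close>.\<close>
  define D where "D x = {y. \<exists>k. (x, y) \<in> E ^^ k \<and> d y = d x + k}" for x
  have D_subset: "D x \<subseteq> insert x (\<Union>w\<in>{w \<in> E `` {x}. d w = Suc (d x)}. D w)"
    if x: "(z, x) \<in> E\<^sup>*" for x
  proof
    fix y assume "y \<in> D x"
    then obtain k where k: "(x, y) \<in> E ^^ k" "d y = d x + k"
      by (auto simp: D_def)
    show "y \<in> insert x (\<Union>w\<in>{w \<in> E `` {x}. d w = Suc (d x)}. D w)"
    proof (cases k)
      case 0
      then show ?thesis using k by simp
    next
      case (Suc k')
      then obtain w where w: "(x, w) \<in> E" "(w, y) \<in> E ^^ k'"
        using k relpow_Suc_D2 by metis
      have "(z, w) \<in> E\<^sup>*"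
        using x w by (rule_tac rtrancl_into_rtrancl)
      from d_relpow[OF this w(2)] have "d y \<le> d w + k'" .
      moreover have "d w \<le> Suc (d x)"
        using d_relpow[OF x, of w 1] w by simp
      ultimately have "d w = Suc (d x)" using k Suc by simp
      then show ?thesis using w k Suc by (auto simp: D_def)
    qed
  qed
  let ?P = "\<lambda>n x. (z, x) \<in> E\<^sup>* \<and> d x = n \<and> infinite (D x)"
  have "\<exists>f. \<forall>n. ?P n (f n) \<and> (f n, f (Suc n)) \<in> E"
  proof (rule dependent_nat_choice)
    have "d z = 0" using d_le[of z 0] by simp
    moreover have "E\<^sup>* `` {z} \<subseteq> D z"
      using d_path \<open>d z = 0\<close> by (auto simp: D_def)
    ultimately have "infinite (D z)" using inf finite_subset by blast
    then show "\<exists>x. ?P 0 x" using \<open>d z = 0\<close> by blast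
  next
    fix x n assume x: "?P n x"
    then have "infinite (\<Union>w\<in>{w \<in> E `` {x}. d w = Suc (d x)}. D w)"
      using finite_subset[OF D_subset[of x]] by auto
    moreover have "finite {w \<in> E `` {x}. d w = Suc (d x)}"
      using fin[of x] by (rule rev_finite_subset) blast
    ultimately obtain w where "(x, w) \<in> E" "d w = Suc (d x)" "infinite (D w)"
      by auto
    moreover from this have "(z, w) \<in> E\<^sup>*"
      using x rtrancl_into_rtrancl[of z x E w] by blast
    ultimately show "\<exists>y. ?P (Suc n) y \<and> (x, y) \<in> E"
      using x by blast
  qed
  then obtain f where f: "\<And>n. ?P n (f n)" "\<And>n. (f n, f (Suc n)) \<in> E"
    by blast
  show thesis
  proof
    show "(f n, f (Suc n)) \<in> E" for n by (rule f)
    show "n \<le> Suc m" if "(f m, f n) \<in> E" for m n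
      using d_relpow[of "f m" "f n" 1] f(1) that by auto
    show "inj f" using f(1) by (metis injI)
  qed
qed

text \<open>\<open>F\<close> gathers the vertices of a walk from \<open>x\<close> to
  \<open>y\<close>. Its finiteness later makes a union of such sets locally finite.\<close>

lemma finite_connected_subset:
  assumes "(x, y) \<in> (E \<inter> S \<times> S)\<^sup>*" "x \<in> S"
  obtains F where "finite F" "F \<subseteq> S" "x \<in> F" "y \<in> F" "\<And>w. w \<in> F \<Longrightarrow> (x, w) \<in> (E \<inter> F \<times> F)\<^sup>*"
  using assms(1)
proof (induction arbitrary: thesis rule: rtrancl_induct)
  case base
  show ?case by (rule base[of "{x}"]) (use assms in auto)
next
  case (step y w)
  obtain F where F: "finite F" "F \<subseteq> S" "x \<in> F" "y \<in> F"
    and conn: "\<And>w. w \<in> F \<Longrightarrow> (x, w) \<in> (E \<inter> F \<times> F)\<^sup>*"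
    using step.IH by blast
  let ?F = "insert w F"
  have "(x, v) \<in> (E \<inter> ?F \<times> ?F)\<^sup>*" if "v \<in> F" for v
    using conn[OF that] by (rule rtrancl_mono[THEN subsetD, rotated]) auto
  moreover have "(y, w) \<in> E \<inter> ?F \<times> ?F" using step.hyps F by auto
  ultimately have "(x, v) \<in> (E \<inter> ?F \<times> ?F)\<^sup>*" if "v \<in> ?F" for v
    using that F(4) by (metis insertE rtrancl_into_rtrancl)
  then show ?case
    using F step.hyps by (intro step.prems[of ?F]) auto
qed

section \<open>Embeddings and duality\<close>

lemma embeds_posetI:
  assumes "inj f" "range f \<subseteq> V" "\<And>x y. (x, y) \<in> p \<longleftrightarrow> (f x, f y) \<in> r"
  shows "embeds_poset V r UNIV p"
  unfolding embeds_poset_def poset_isomorphic_def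
  using assms by (intro exI[of _ "range f"] conjI exI[of _ f]) (auto simp: bij_betw_def)

lemma embeds_poset_converse:
  "embeds_poset V (r\<inverse>) W p \<longleftrightarrow> embeds_poset V r W (p\<inverse>)"
proof -
  have "poset_isomorphic W p A (r\<inverse> \<inter> A \<times> A) \<longleftrightarrow> poset_isomorphic W (p\<inverse>) A (r \<inter> A \<times> A)" for A
    unfolding poset_isomorphic_def by (simp add: conj_commute) blast
  then show ?thesis by (simp add: embeds_poset_def)
qed

lemma autonomous_converse: "autonomous V (r\<inverse>) A \<longleftrightarrow> autonomous V r A"
  unfolding autonomous_def slt_def by auto

lemma prime_poset_converse: "prime_poset V (r\<inverse>) \<longleftrightarrow> prime_poset V r"
  by (simp add: prime_poset_def autonomous_converse)

lemma antichain_in_converse: "antichain_in V (r\<inverse>) A \<longleftrightarrow> antichain_in V r A"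
  unfolding antichain_in_def by auto

section \<open>Posets without infinite antichains\<close>

text \<open>Primality is left out of the locale; the assumptions are self-dual, so that it can be
  interpreted for both \<open>r\<close> and \<open>r\<inverse>\<close>.\<close>

locale narrow_poset =
  fixes V :: "'a set" and r :: "'a rel"
  assumes order: "partial_order_on V r"
    and narrow: "antichain_in V r A \<Longrightarrow> finite A"
begin

abbreviation less (infix "\<sqsubset>" 50) where "x \<sqsubset> y \<equiv> slt r x y"

definition incomparable (infix "\<parallel>" 50) where
  "x \<parallel> y \<longleftrightarrow> x \<in> V \<and> y \<in> V \<and> (x, y) \<notin> r \<and> (y, x) \<notin> r"

lemma refl: "x \<in> V \<Longrightarrow> (x, x) \<in> r"
  using order by (auto simp: partial_order_on_def preorder_on_def refl_on_def)

lemma less_carrier: "x \<sqsubset> y \<Longrightarrow> x \<in> V \<and> y \<in> V"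
  using order by (auto simp: partial_order_on_def preorder_on_def slt_def)

lemma less_trans [trans]: "x \<sqsubset> y \<Longrightarrow> y \<sqsubset> z \<Longrightarrow> x \<sqsubset> z"
  using order unfolding partial_order_on_def preorder_on_def slt_def trans_def antisym_def by metis

lemma less_irrefl: "\<not> x \<sqsubset> x"
  by (simp add: slt_def)

lemma less_asym: "x \<sqsubset> y \<Longrightarrow> \<not> y \<sqsubset> x"
  using less_trans less_irrefl by blast

lemma comparison_cases:
  assumes "x \<in> V" "y \<in> V"
  obtains "x \<sqsubset> y" | "y \<sqsubset> x" | "x = y" | "x \<parallel> y"
  using assms by (auto simp: incomparable_def slt_def)

lemma incomparableI:
  "x \<in> V \<Longrightarrow> y \<in> V \<Longrightarrow> \<not> x \<sqsubset> y \<Longrightarrow> \<not> y \<sqsubset> x \<Longrightarrow> x \<noteq> y \<Longrightarrow> x \<parallel> y"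
  by (auto simp: incomparable_def slt_def)

lemma incomparable_sym: "x \<parallel> y \<Longrightarrow> y \<parallel> x"
  by (simp add: incomparable_def)

lemma incomparableD:
  assumes "x \<parallel> y"
  shows "\<not> x \<sqsubset> y" "\<not> y \<sqsubset> x" "x \<noteq> y" "x \<in> V" "y \<in> V"
  using assms refl by (auto simp: incomparable_def slt_def)

text \<open>Ramsey's theorem with three colours for pairs of indices: ascending, descending,
  incomparable. An infinite set homogeneous in the third colour would give an infinite
  antichain.\<close>

lemma monotone_subsequence:
  fixes s :: "nat \<Rightarrow> 'a"
  assumes inj: "inj s" and V: "range s \<subseteq> V"
  obtains \<phi> :: "nat \<Rightarrow> nat" where "strict_mono \<phi>"
    "(\<forall>i j. i < j \<longrightarrow> s (\<phi> i) \<sqsubset> s (\<phi> j)) \<or> (\<forall>i j. i < j \<longrightarrow> s (\<phi> j) \<sqsubset> s (\<phi> i))"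
proof -
  \<comment> \<open>Colours are attached to unordered pairs; \<open>Min\<close> and
    \<open>Max\<close> recover the order of the indices.\<close>
  define col :: "nat set \<Rightarrow> nat" where
    "col X = (if s (Min X) \<sqsubset> s (Max X) then 0 else if s (Max X) \<sqsubset> s (Min X) then 1 else 2)" for X
  have col: "col {i, j} = (if s i \<sqsubset> s j then 0 else if s j \<sqsubset> s i then 1 else 2)" if "i < j" for i j
    using that by (simp add: col_def)
  have col_less: "col X < 3" for X by (simp add: col_def)
  obtain Y t where Y: "infinite Y" and t: "t < 3"
    and hom: "\<forall>x\<in>Y. \<forall>y\<in>Y. x \<noteq> y \<longrightarrow> col {x, y} = t"
    using Ramsey2[of "UNIV :: nat set" col 3] col_less infinite_UNIV_nat by blast
  define \<phi> where "\<phi> = enumerate Y"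
  have mono: "strict_mono \<phi>"
    unfolding \<phi>_def using Y by (simp add: strict_mono_def enumerate_mono)
  have hom': "col {\<phi> i, \<phi> j} = t" if "i < j" for i j
  proof -
    have "\<phi> i \<in> Y" "\<phi> j \<in> Y" unfolding \<phi>_def using Y by (rule enumerate_in_set)+
    then show ?thesis using hom strict_monoD[OF mono that] by auto
  qed
  have "t \<noteq> 2"
  proof
    assume "t = 2"
    have incomp: "(s x, s y) \<notin> r \<and> (s y, s x) \<notin> r" if xy: "x \<in> Y" "y \<in> Y" "x < y" for x y
    proof -
      have "col {x, y} = 2" using hom xy \<open>t = 2\<close> by auto
      moreover have "s x \<noteq> s y" using inj xy by (auto dest: injD)
      ultimately show ?thesis using col[OF xy(3)] by (auto simp: slt_def split: if_splits)
    qed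
    then have "antichain_in V r (s ` Y)"
      unfolding antichain_in_def
    proof (intro conjI ballI impI)
      show "s ` Y \<subseteq> V" using V by blast
      fix p q assume "p \<in> s ` Y" "q \<in> s ` Y" "p \<noteq> q"
      then obtain x y where xy: "x \<in> Y" "y \<in> Y" "p = s x" "q = s y" "x < y \<or> y < x"
        by (metis imageE linorder_neqE_nat)
      then show "(p, q) \<notin> r" "(q, p) \<notin> r" using incomp by blast+
    qed
    then have "finite (s ` Y)" by (rule narrow)
    then show False
      using Y inj by (meson finite_imageD inj_on_subset subset_UNIV)
  qed
  then consider "t = 0" | "t = 1" using t by linarith
  then show thesis
  proof cases
    case 1
    have "s (\<phi> i) \<sqsubset> s (\<phi> j)" if "i < j" for i j
    proof -
      have "col {\<phi> i, \<phi> j} = 0" using hom'[OF that] 1 by metis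
      then show ?thesis unfolding col[OF strict_monoD[OF mono that]]
        by (metis one_neq_zero zero_neq_numeral)
    qed
    then show thesis using that[OF mono] by blast
  next
    case 2
    have "s (\<phi> j) \<sqsubset> s (\<phi> i)" if "i < j" for i j
    proof -
      have "col {\<phi> i, \<phi> j} = 1" using hom'[OF that] 2 by metis
      then show ?thesis unfolding col[OF strict_monoD[OF mono that]]
        by (metis numeral_eq_one_iff one_neq_zero num.distinct(1))
    qed
    then show thesis using that[OF mono] by blast
  qed
qed

lemma decreasing_subsequence:
  fixes s :: "nat \<Rightarrow> 'a"
  assumes inj: "inj s" and V: "range s \<subseteq> V" and not_less: "\<And>i j. i < j \<Longrightarrow> \<not> s i \<sqsubset> s j"
  obtains \<phi> :: "nat \<Rightarrow> nat" where "strict_mono \<phi>" "\<And>i j. i < j \<Longrightarrow> s (\<phi> j) \<sqsubset> s (\<phi> i)"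
proof -
  obtain \<phi> :: "nat \<Rightarrow> nat" where \<phi>: "strict_mono \<phi>" and
    mono: "(\<forall>i j. i < j \<longrightarrow> s (\<phi> i) \<sqsubset> s (\<phi> j)) \<or> (\<forall>i j. i < j \<longrightarrow> s (\<phi> j) \<sqsubset> s (\<phi> i))"
    by (rule monotone_subsequence[OF inj V])
  have "\<not> s (\<phi> 0) \<sqsubset> s (\<phi> 1)"
    using strict_monoD[OF \<phi>, of 0 1] by (intro not_less) simp
  then have "\<forall>i j. i < j \<longrightarrow> s (\<phi> j) \<sqsubset> s (\<phi> i)"
    using mono zero_less_one by blast
  then show thesis using that[OF \<phi>] by blast
qed

section \<open>Recognising \<open>P1\<close> and \<open>P2\<close>\<close>

text \<open>The relations between the two families suffice. If \<open>i < j\<close>, then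
  \<open>a i\<close> below \<open>a j\<close> would put \<open>a i\<close> below \<open>b i\<close>,
  and \<open>b i\<close> below \<open>b j\<close> would put \<open>a j\<close> below
  \<open>b j\<close>, both excluded on the diagonal. So each family has a decreasing
  subsequence.\<close>

lemma embeds_P1:
  fixes a b :: "nat \<Rightarrow> 'a"
  assumes less: "\<And>i j. j < i \<Longrightarrow> a i \<sqsubset> b j" and inc: "\<And>i j. i \<le> j \<Longrightarrow> a i \<parallel> b j"
  shows "embeds_poset V r UNIV P1"
proof -
  have diag: "a i \<parallel> b i" for i by (rule inc) simp
  have "a i \<noteq> a j" "\<not> a i \<sqsubset> a j" if "i < j" for i j
    using less[OF that] diag[of i] less_trans[of "a i" "a j" "b i"] incomparableD(1) by auto
  moreover have "range a \<subseteq> V" using incomparableD(4)[OF diag] by blast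
  ultimately obtain \<phi> :: "nat \<Rightarrow> nat" where \<phi>: "strict_mono \<phi>"
    and a: "\<And>i j. i < j \<Longrightarrow> a (\<phi> j) \<sqsubset> a (\<phi> i)"
    using decreasing_subsequence[of a] linorder_injI[of a] by blast
  define b' where "b' = b \<circ> \<phi>"
  have "b' i \<noteq> b' j" "\<not> b' i \<sqsubset> b' j" if "i < j" for i j
    using less[OF strict_monoD[OF \<phi> that]] diag[of "\<phi> j"] incomparableD(1)
      less_trans[of "a (\<phi> j)" "b (\<phi> i)" "b (\<phi> j)"]
    by (auto simp: b'_def)
  moreover have "range b' \<subseteq> V" using incomparableD(5)[OF diag] by (auto simp: b'_def)
  ultimately obtain \<psi> :: "nat \<Rightarrow> nat" where \<psi>: "strict_mono \<psi>"
    and b: "\<And>i j. i < j \<Longrightarrow> b' (\<psi> j) \<sqsubset> b' (\<psi> i)"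
    using decreasing_subsequence[of b'] linorder_injI[of b'] by blast
  \<comment> \<open>Both families are thinned along the same indices, so the relations between them
    keep their form.\<close>
  define \<theta> where "\<theta> = \<phi> \<circ> \<psi>"
  have \<theta>: "strict_mono \<theta>" using \<phi> \<psi> by (simp add: \<theta>_def strict_mono_def)
  have aa: "a (\<theta> j) \<sqsubset> a (\<theta> i)" if "i < j" for i j
    using a \<psi> that by (simp add: \<theta>_def strict_monoD)
  have bb: "b (\<theta> j) \<sqsubset> b (\<theta> i)" if "i < j" for i j
    using b that by (simp add: \<theta>_def b'_def)
  have ab: "a (\<theta> i) \<sqsubset> b (\<theta> j)" if "j < i" for i j
    using less \<theta> that by (simp add: strict_monoD)
  have inc': "a (\<theta> i) \<parallel> b (\<theta> j)" if "i \<le> j" for i j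
    using inc \<theta> that by (simp add: strict_mono_less_eq)
  define f where "f = (\<lambda>VA i \<Rightarrow> a (\<theta> i) | VB i \<Rightarrow> b (\<theta> i))"
  have fV: "f x \<in> V" for x
    using incomparableD(4,5)[OF inc'[OF order_refl]] by (auto simp: f_def split: vertex.split)
  have lessI: "f x \<sqsubset> f y" if "P1_less x y" for x y
    using that aa bb ab by (cases x; cases y) (auto simp: f_def)
  \<comment> \<open>\<open>lessI\<close> only preserves the order; reflecting it requires that
    unrelated vertices of \<open>P1\<close> have incomparable images.\<close>
  have trichotomy: "P1_less x y \<or> P1_less y x \<or> f x \<parallel> f y" if "x \<noteq> y" for x y
  proof -
    have "a (\<theta> i) \<parallel> b (\<theta> j)" "b (\<theta> j) \<parallel> a (\<theta> i)" if "\<not> j < i" for i j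
      using inc'[of i j] that incomparable_sym by simp_all
    then show ?thesis using that by (cases x; cases y) (force simp: f_def)+
  qed
  have iff: "(x, y) \<in> P1 \<longleftrightarrow> (f x, f y) \<in> r" for x y
  proof (cases "x = y")
    case True
    then show ?thesis using refl[OF fV] by (simp add: P1_def)
  next
    case False
    then have neq: "f x \<noteq> f y"
      using lessI[of x y] lessI[of y x] trichotomy[of x y] incomparableD(3)
      by (auto simp: slt_def)
    then show ?thesis
      using False lessI[of x y] lessI[of y x] trichotomy[of x y] less_asym[of "f y" "f x"]
      unfolding P1_def incomparable_def slt_def by blast
  qed
  show ?thesis
  proof (rule embeds_posetI[OF _ _ iff])
    show "inj f"
    proof (rule injI, rule ccontr)
      fix x y assume "f x = f y" "x \<noteq> y"
      then show False
        using lessI[of x y] lessI[of y x] trichotomy[of x y] less_irrefl incomparableD(3) by auto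
    qed
  qed (use fV in auto)
qed

text \<open>The order pulled back along \<open>f\<close> is a transitive orientation of the
  complement of \<open>G2\<close>, and there are only two of these.\<close>

lemma embeds_P2:
  fixes f :: "nat \<Rightarrow> 'a"
  assumes inj: "inj f" and V: "range f \<subseteq> V" and inc: "\<And>m n. f m \<parallel> f n \<longleftrightarrow> G2 m n"
  shows "embeds_poset V r UNIV P2 \<or> embeds_poset V r UNIV (P2\<inverse>)"
proof -
  let ?p = "{(m, n). (f m, f n) \<in> r}"
  have "refl_on UNIV ?p"
    using V refl by (auto simp: refl_on_def)
  moreover have "trans ?p" "antisym ?p"
    using order inj unfolding partial_order_on_def preorder_on_def trans_def antisym_def inj_def
    by blast+
  moreover have "complement_graph G2 m n \<longleftrightarrow> m \<noteq> n \<and> ((m, n) \<in> ?p \<or> (n, m) \<in> ?p)" for m n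
    using V inc[of m n] by (auto simp: complement_graph_def incomparable_def)
  ultimately have "transitive_orientation (complement_graph G2) ?p"
    by (simp add: transitive_orientation_def partial_order_on_def preorder_on_def)
  then have "?p = P2 \<or> ?p = P2\<inverse>"
    by (simp add: transitive_orientations_G2)
  moreover have "embeds_poset V r UNIV ?p"
    using inj V by (intro embeds_posetI) auto
  ultimately show ?thesis by auto
qed

section \<open>Components of incomparability graphs\<close>

definition incomparability :: "'a set \<Rightarrow> 'a rel" where
  "incomparability S = {(x, y). x \<parallel> y} \<inter> S \<times> S"

lemma sym_connected: "sym ((incomparability S)\<^sup>*)"
  by (rule sym_rtrancl) (auto simp: incomparability_def sym_def incomparable_sym)

text \<open>A component not containing \<open>w\<close> lies on one side of \<open>w\<close>: a
  neighbour \<open>y\<close> of some \<open>x\<close> below \<open>w\<close> cannot be above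
  \<open>w\<close>, by transitivity, and cannot equal or be incomparable to \<open>w\<close>, which
  would put \<open>w\<close> into the component.\<close>

lemma separated_less:
  assumes "(u, u') \<in> (incomparability S)\<^sup>*" "u \<sqsubset> w" "w \<in> S"
    and "(u, w) \<notin> (incomparability S)\<^sup>*"
  shows "u' \<sqsubset> w"
  using assms(1)
proof (induction rule: rtrancl_induct)
  case (step x y)
  then have xy: "x \<parallel> y" "y \<in> S" by (auto simp: incomparability_def)
  have conn: "(u, y) \<in> (incomparability S)\<^sup>*"
    using step.hyps by (rule rtrancl_into_rtrancl)
  have "y \<in> V" "w \<in> V" using xy assms(2) incomparableD less_carrier by blast+
  then show ?case
  proof (cases rule: comparison_cases)
    case 4
    then have "(y, w) \<in> incomparability S" using xy assms(3) by (simp add: incomparability_def)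
    then show ?thesis using conn assms(4) by (meson rtrancl_into_rtrancl)
  next
    case 3
    then show ?thesis using conn assms(4) by simp
  next
    case 2
    then show ?thesis using step.IH xy less_trans incomparableD by blast
  qed
qed (use assms in simp)

end

section \<open>The up-closure of a decreasing sequence\<close>

locale decreasing_sequence = narrow_poset +
  fixes c :: "nat \<Rightarrow> 'a"
  assumes decreasing: "i < j \<Longrightarrow> c j \<sqsubset> c i"
begin

text \<open>The strict relation loses nothing, because \<open>c n\<close> lies above
  \<open>c (Suc n)\<close>.\<close>

definition U :: "'a set" where "U = {u. \<exists>n. c n \<sqsubset> u}"

abbreviation connected :: "'a \<Rightarrow> 'a \<Rightarrow> bool" (infix "\<sim>" 50) where
  "x \<sim> y \<equiv> (x, y) \<in> (incomparability U)\<^sup>*"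

lemma c_V: "c n \<in> V"
  using decreasing[of n "Suc n"] less_carrier by blast

lemma c_U: "c n \<in> U"
  using decreasing[of n "Suc n"] by (auto simp: U_def)

lemma U_V: "U \<subseteq> V"
  using less_carrier by (auto simp: U_def)

lemma U_up: "x \<in> U \<Longrightarrow> x \<sqsubset> y \<Longrightarrow> y \<in> U"
  using less_trans by (auto simp: U_def)

lemma c_inj: "c i = c j \<Longrightarrow> i = j"
  using decreasing less_irrefl by (metis linorder_neqE_nat)

lemma c_trans: "c i \<sqsubset> x \<Longrightarrow> i \<le> j \<Longrightarrow> c j \<sqsubset> x"
  using decreasing less_trans by (metis le_neq_implies_less)

lemma c_trans': "x \<sqsubset> c j \<Longrightarrow> i \<le> j \<Longrightarrow> x \<sqsubset> c i"
  using decreasing less_trans by (metis le_neq_implies_less)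

text \<open>Each chosen \<open>v\<close> is below an initial segment of \<open>c\<close> and
  incomparable to the rest, being outside \<open>U\<close>. Restarting where one \<open>v\<close>
  stops being below \<open>c\<close> gives the pattern of \<open>P1\<close>, with the
  \<open>v\<close> as \<open>a\<close> and terms of \<open>c\<close> as \<open>b\<close>.\<close>

lemma embeds_P1_if_splitting:
  assumes split: "\<And>k. \<exists>v. v \<notin> U \<and> v \<sqsubset> c k \<and> (\<exists>j. \<not> v \<sqsubset> c j)"
  shows "embeds_poset V r UNIV P1"
proof -
  obtain f where f: "\<And>k. f k \<notin> U" "\<And>k. f k \<sqsubset> c k" "\<And>k. \<exists>j. \<not> f k \<sqsubset> c j"
    using split by metis
  then obtain g where g: "\<And>k. \<not> f k \<sqsubset> c (g k)" by metis
  define k where "k i = (g ^^ i) 0" for i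
  have k_Suc: "k (Suc i) = g (k i)" for i by (simp add: k_def)
  have "k i < k (Suc i)" for i
    using g[of "k i"] c_trans'[OF f(2)[of "k i"], of "g (k i)"] unfolding k_Suc by linarith
  then have k: "strict_mono k" by (simp add: strict_mono_Suc_iff)
  show ?thesis
  \<comment> \<open>The shift to \<open>Suc i\<close> makes the diagonal incomparable:
    \<open>f (k i)\<close> is below \<open>c (k i)\<close> but not below
    \<open>c (k (Suc i))\<close>.\<close>
  proof (rule embeds_P1[of "\<lambda>i. f (k i)" "\<lambda>i. c (k (Suc i))"])
    fix i j :: nat
    show "f (k i) \<sqsubset> c (k (Suc j))" if "j < i"
      using that k by (intro c_trans'[OF f(2)]) (simp add: strict_mono_less_eq)
    show "f (k i) \<parallel> c (k (Suc j))" if "i \<le> j"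
    proof -
      have "\<not> f (k i) \<sqsubset> c (k (Suc j))"
        using g[of "k i"] c_trans'[of "f (k i)" "k (Suc j)" "k (Suc i)"] k that
        by (auto simp: k_Suc[symmetric] strict_mono_less_eq)
      moreover have "\<not> c (k (Suc j)) \<sqsubset> f (k i)" "f (k i) \<noteq> c (k (Suc j))"
        using f(1)[of "k i"] c_U[of "k (Suc j)"] by (auto simp: U_def)
      moreover have "f (k i) \<in> V" using f(2) less_carrier by blast
      ultimately show ?thesis by (intro incomparableI c_V)
    qed
  qed
qed

text \<open>Here terms of \<open>c\<close> serve as \<open>a\<close> and neighbours of
  \<open>u\<close> as \<open>b\<close>. Each neighbour is above some later term of \<open>c\<close>,
  where the next one is chosen.\<close>

lemma embeds_P1_if_unbounded_neighbours:
  assumes u: "u \<in> U" and unbounded: "\<And>m. \<exists>w\<in>U. u \<parallel> w \<and> \<not> c m \<sqsubset> w"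
  shows "embeds_poset V r UNIV P1"
proof -
  obtain p where p: "c p \<sqsubset> u" using u by (auto simp: U_def)
  obtain f where f: "\<And>m. f m \<in> U" "\<And>m. u \<parallel> f m" "\<And>m. \<not> c m \<sqsubset> f m"
    using unbounded by metis
  then obtain g where g: "\<And>m. c (g m) \<sqsubset> f m" by (auto simp: U_def) metis
  \<comment> \<open>Starting at \<open>p\<close> keeps every \<open>c (k i)\<close> below
    \<open>u\<close>, so that no neighbour of \<open>u\<close> can be below or equal to it.\<close>
  define k where "k i = (g ^^ i) p" for i
  have k_Suc: "k (Suc i) = g (k i)" for i by (simp add: k_def)
  have "k i < k (Suc i)" for i
    using f(3)[of "k i"] c_trans[OF g[of "k i"], of "k i"] unfolding k_Suc by linarith
  then have k: "strict_mono k" by (simp add: strict_mono_Suc_iff)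
  have below_u: "c (k i) \<sqsubset> u" for i
    using k strict_mono_less_eq[of k 0 i] by (intro c_trans[OF p]) (simp add: k_def)
  show ?thesis
  proof (rule embeds_P1[of "\<lambda>i. c (k i)" "\<lambda>i. f (k i)"])
    fix i j :: nat
    show "c (k i) \<sqsubset> f (k j)" if "j < i"
      using that k by (intro c_trans[OF g]) (simp add: k_Suc[symmetric] strict_mono_less_eq)
    show "c (k i) \<parallel> f (k j)" if "i \<le> j"
    proof -
      have "\<not> c (k i) \<sqsubset> f (k j)"
        using f(3)[of "k j"] c_trans[of "k i" "f (k j)" "k j"] k that
        by (auto simp: strict_mono_less_eq)
      moreover have "\<not> f (k j) \<sqsubset> c (k i)" "c (k i) \<noteq> f (k j)"
        using incomparableD(2)[OF f(2)[of "k j"]] below_u[of i] less_trans[OF _ below_u[of i]]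
        by auto
      moreover have "f (k j) \<in> V" using f(1) U_V by blast
      ultimately show ?thesis by (intro incomparableI c_V)
    qed
  qed
qed

text \<open>
  Going from \<open>c\<^bsub>Suc j\<^esub>\<close> to \<open>c\<^sub>j\<close>, the first vertex not below \<open>c\<^sub>j\<close> is \<open>c\<^sub>j\<close> or a neighbour of it.
\<close>

lemma path_avoiding_above:
  assumes "c j \<sim> c (Suc j)"
  shows "(c j, c (Suc j)) \<in> (incomparability (U - {w. c j \<sqsubset> w}))\<^sup>*"
proof -
  let ?S = "U - {w. c j \<sqsubset> w}"
  have "(c (Suc j), z) \<in> (incomparability ?S)\<^sup>* \<and> z \<sqsubset> c j \<or>
        (c (Suc j), c j) \<in> (incomparability ?S)\<^sup>*" if "c (Suc j) \<sim> z" for z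
    using that
  proof (induction rule: rtrancl_induct)
    case base
    then show ?case using decreasing by simp
  next
    case (step x y)
    then have xy: "x \<parallel> y" "x \<in> U" "y \<in> U" by (auto simp: incomparability_def)
    consider "(c (Suc j), x) \<in> (incomparability ?S)\<^sup>*" "x \<sqsubset> c j"
      | "(c (Suc j), c j) \<in> (incomparability ?S)\<^sup>*"
      using step.IH by blast
    then show ?case
    proof cases
      case 1
      have not_above: "\<not> c j \<sqsubset> y"
        using 1 xy less_trans incomparableD by blast
      then have "(x, y) \<in> incomparability ?S"
        using 1 xy less_asym by (auto simp: incomparability_def)
      with 1 have path: "(c (Suc j), y) \<in> (incomparability ?S)\<^sup>*"
        by (meson rtrancl_into_rtrancl)
      have "y \<in> V" using xy U_V by blast
      from this c_V[of j] show ?thesis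
      proof (cases rule: comparison_cases)
        case 4
        then have "(y, c j) \<in> incomparability ?S"
          using not_above xy c_U less_irrefl by (auto simp: incomparability_def)
        then show ?thesis using path by (meson rtrancl_into_rtrancl)
      qed (use path not_above in auto)
    qed simp
  qed
  \<comment> \<open>For \<open>z = c j\<close> the first alternative would put \<open>c j\<close>
    strictly below itself.\<close>
  from this[of "c j"] have "(c (Suc j), c j) \<in> (incomparability ?S)\<^sup>*"
    using assms symD[OF sym_connected] less_irrefl by blast
  then show ?thesis using symD[OF sym_connected] by blast
qed

text \<open>The paths avoid what is above \<open>c j\<close>, whereas all neighbours of a vertex in
  \<open>U\<close> are above one \<open>c m\<close>. Hence only paths with \<open>j < m\<close>
  contain such neighbours, and the union of the paths is locally finite.\<close>

lemma embeds_P2_if_bounded_neighbours: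
  assumes conn: "\<And>j. k \<le> j \<Longrightarrow> c j \<sim> c (Suc j)"
    and bounded: "\<And>u. u \<in> U \<Longrightarrow> \<exists>m. \<forall>w\<in>U. u \<parallel> w \<longrightarrow> c m \<sqsubset> w"
  shows "embeds_poset V r UNIV P2 \<or> embeds_poset V r UNIV (P2\<inverse>)"
proof -
  have "\<exists>F. finite F \<and> F \<subseteq> U - {w. c j \<sqsubset> w} \<and> c j \<in> F \<and> c (Suc j) \<in> F \<and>
      (\<forall>w\<in>F. (c j, w) \<in> (incomparability F)\<^sup>*)" if "k \<le> j" for j
  proof -
    have "c j \<in> U - {w. c j \<sqsubset> w}" using c_U less_irrefl by auto
    from finite_connected_subset[OF path_avoiding_above[OF conn[OF that], unfolded incomparability_def] this]
    show ?thesis unfolding incomparability_def by metis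
  qed
  then obtain F where F: "\<And>j. k \<le> j \<Longrightarrow> finite (F j)"
      "\<And>j. k \<le> j \<Longrightarrow> F j \<subseteq> U - {w. c j \<sqsubset> w}"
      "\<And>j. k \<le> j \<Longrightarrow> c j \<in> F j" "\<And>j. k \<le> j \<Longrightarrow> c (Suc j) \<in> F j"
      "\<And>j w. k \<le> j \<Longrightarrow> w \<in> F j \<Longrightarrow> (c j, w) \<in> (incomparability (F j))\<^sup>*"
    by metis
  define H where "H = (\<Union>j\<in>{k..}. F j)"
  let ?E = "incomparability H"
  have H_U: "H \<subseteq> U" using F(2) by (auto simp: H_def)
  have F_path: "(c j, w) \<in> ?E\<^sup>*" if "k \<le> j" "w \<in> F j" for j w
  proof -
    have "incomparability (F j) \<subseteq> ?E" using that by (auto simp: H_def incomparability_def)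
    then show ?thesis using F(5)[OF that] rtrancl_mono by blast
  qed
  have "(c k, c j) \<in> ?E\<^sup>*" if "k \<le> j" for j
    using that
  proof (induction rule: dec_induct)
    case (step n)
    then show ?case using F_path F(4) by (meson rtrancl_trans)
  qed simp
  then have "c ` {k..} \<subseteq> ?E\<^sup>* `` {c k}" by auto
  moreover have "infinite (c ` {k..})"
    using c_inj by (metis finite_imageD inj_onI infinite_Ici)
  ultimately have infinite: "infinite (?E\<^sup>* `` {c k})" using finite_subset by blast
  have locally_finite: "finite (?E `` {x})" for x
  proof (cases "x \<in> U")
    case True
    then obtain m where m: "\<And>w. w \<in> U \<Longrightarrow> x \<parallel> w \<Longrightarrow> c m \<sqsubset> w" using bounded by blast
    have "?E `` {x} \<subseteq> (\<Union>j\<in>{k..<m}. F j)"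
    proof
      fix w assume "w \<in> ?E `` {x}"
      then have w: "x \<parallel> w" "w \<in> H" by (auto simp: incomparability_def)
      then obtain j where j: "k \<le> j" "w \<in> F j" by (auto simp: H_def)
      have "c m \<sqsubset> w" using m w H_U by blast
      then have "\<not> m \<le> j" using F(2)[OF j(1)] j(2) c_trans by blast
      then show "w \<in> (\<Union>j\<in>{k..<m}. F j)" using j by auto
    qed
    then show ?thesis by (rule finite_subset) (use F(1) in auto)
  next
    case False
    then have "?E `` {x} = {}" using H_U by (auto simp: incomparability_def)
    then show ?thesis by simp
  qed
  obtain f where f: "\<And>n. (f n, f (Suc n)) \<in> ?E" "\<And>m n. (f m, f n) \<in> ?E \<Longrightarrow> n \<le> Suc m" "inj f"
    using geodesic_ray[OF locally_finite infinite] by blast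
  have f_H: "f n \<in> H" for n using f(1)[of n] by (auto simp: incomparability_def)
  have "f m \<parallel> f n \<longleftrightarrow> G2 m n" for m n
  proof
    assume inc: "f m \<parallel> f n"
    then have "(f m, f n) \<in> ?E" "(f n, f m) \<in> ?E"
      using f_H incomparable_sym by (auto simp: incomparability_def)
    \<comment> \<open>Symmetry of incomparability turns the one-sided bound for the ray into a
      two-sided one.\<close>
    from this[THEN f(2)] have "n \<le> Suc m" "m \<le> Suc n" .
    moreover have "m \<noteq> n" using incomparableD(3)[OF inc] by auto
    ultimately show "G2 m n" unfolding G2_def by linarith
  next
    assume "G2 m n"
    then show "f m \<parallel> f n"
      using f(1) incomparable_sym by (auto simp: G2_def incomparability_def)
  qed
  moreover have "range f \<subseteq> V" using f_H H_U U_V by blast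
  ultimately show ?thesis using embeds_P2 f(3) by blast
qed

section \<open>Primality and the case distinction\<close>

text \<open>The set \<open>A\<close> contains \<open>c n\<close> and \<open>c (Suc n)\<close> but
  not \<open>c k\<close>, so primality yields some \<open>v\<close> splitting it. Elements of
  \<open>U - A\<close> are above all of \<open>A\<close> and cannot split it. So \<open>v\<close> is
  outside \<open>U\<close>, and as \<open>U\<close> is upward closed, \<open>v\<close> is below some
  but not all elements of \<open>A\<close>.\<close>

lemma splitting_if_disconnected:
  assumes prime: "prime_poset V r"
    and disconnected: "\<And>k. \<exists>j>k. \<not> c k \<sim> c j"
  shows "\<exists>v. v \<notin> U \<and> v \<sqsubset> c k \<and> (\<exists>j. \<not> v \<sqsubset> c j)"
proof -
  obtain n where n: "k < n" "\<not> c k \<sim> c n" using disconnected by blast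
  define A where "A = {u \<in> U. c n \<sim> u \<or> u \<sqsubset> c n}"
  have A_below: "a \<sqsubset> c k" if "a \<in> A" for a
  proof -
    have "\<not> c n \<sim> c k" using n symD[OF sym_connected] by blast
    then show ?thesis
      using that separated_less[of "c n" a U "c k"] decreasing[OF n(1)] c_U less_trans
      unfolding A_def by blast
  qed
  have "c k \<notin> A" using A_below less_irrefl by blast
  moreover have "c n \<in> A" "c (Suc n) \<in> A"
    using c_U decreasing by (auto simp: A_def)
  moreover have "c n \<noteq> c (Suc n)" using c_inj by fastforce
  ultimately have "\<not> trivial_subset V A"
    using c_V unfolding trivial_subset_def by (metis empty_iff singletonD)
  then have "\<not> autonomous V r A" using prime by (auto simp: prime_poset_def)
  moreover have "A \<subseteq> V" using U_V by (auto simp: A_def)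
  ultimately obtain v a a' where v: "v \<in> V" "v \<notin> A" and a: "a \<in> A" "a' \<in> A"
    and split: "v \<sqsubset> a \<and> \<not> v \<sqsubset> a' \<or> a \<sqsubset> v \<and> \<not> a' \<sqsubset> v"
    unfolding autonomous_def by blast
  have above: "x \<sqsubset> v" if "v \<in> U" "x \<in> A" for x
  proof -
    have not_conn: "\<not> c n \<sim> v" "\<not> v \<sqsubset> c n" using v that by (auto simp: A_def)
    \<comment> \<open>Being in another component, \<open>v\<close> is comparable to
      \<open>c n\<close>; being outside \<open>A\<close>, it is not below it.\<close>
    have "c n \<sqsubset> v"
    proof -
      have "(c n, v) \<notin> incomparability U" using not_conn by blast
      then have "\<not> c n \<parallel> v" using that c_U by (auto simp: incomparability_def)
      moreover have "c n \<noteq> v" using not_conn by auto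
      ultimately show ?thesis using incomparableI[of "c n" v] not_conn v c_V by blast
    qed
    then show ?thesis
      using that separated_less[of "c n" x U v] not_conn less_trans unfolding A_def by blast
  qed
  have "v \<notin> U"
    using above a split less_asym by blast
  then have "v \<sqsubset> a" "\<not> v \<sqsubset> a'"
    using split a U_up by (auto simp: A_def)
  \<comment> \<open>This \<open>j\<close> is a witness: \<open>v\<close> below \<open>c j\<close>
    would imply \<open>v\<close> below \<open>a'\<close>.\<close>
  moreover obtain j where "c j \<sqsubset> a'" using a by (auto simp: A_def U_def)
  ultimately show ?thesis
    using \<open>v \<notin> U\<close> A_below a less_trans by blast
qed

text \<open>\<open>P1\<inverse>\<close> is absent here; it enters through duality, when the monotone
  sequence increases.\<close>

theorem embeds_P1_or_P2:
  assumes "prime_poset V r"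
  shows "embeds_poset V r UNIV P1 \<or> embeds_poset V r UNIV P2 \<or> embeds_poset V r UNIV (P2\<inverse>)"
proof (cases "\<exists>k. \<forall>j>k. c k \<sim> c j")
  case True
  then obtain k where k: "\<And>j. k < j \<Longrightarrow> c k \<sim> c j" by blast
  then have "c k \<sim> c j" if "k \<le> j" for j
    using that by (cases "k = j") auto
  then have "c j \<sim> c (Suc j)" if "k \<le> j" for j
    using that symD[OF sym_connected] by (meson le_Suc_eq rtrancl_trans)
  then show ?thesis
    using embeds_P2_if_bounded_neighbours embeds_P1_if_unbounded_neighbours by metis
next
  case False
  then have "\<exists>v. v \<notin> U \<and> v \<sqsubset> c k \<and> (\<exists>j. \<not> v \<sqsubset> c j)" for k
    using splitting_if_disconnected[OF assms] by blast
  then show ?thesis using embeds_P1_if_splitting by blast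
qed

end

theorem theorem6:
  fixes V :: "'a set" and r :: "'a rel"
  assumes "prime_poset V r"
    and "infinite V"
    and "\<nexists>A. antichain_in V r A \<and> infinite A"
  shows "embeds_poset V r (UNIV :: vertex set) P1
       \<or> embeds_poset V r (UNIV :: vertex set) (P1\<inverse>)
       \<or> embeds_poset V r (UNIV :: nat set) P2
       \<or> embeds_poset V r (UNIV :: nat set) (P2\<inverse>)"
proof -
  interpret narrow_poset V r
    using assms by unfold_locales (auto simp: prime_poset_def)
  interpret dual: narrow_poset V "r\<inverse>"
    using assms by unfold_locales (auto simp: prime_poset_def antichain_in_converse)
  obtain s :: "nat \<Rightarrow> 'a" where s: "inj s" "range s \<subseteq> V"
    using infinite_countable_subset[OF assms(2)] by blast
  obtain \<phi> :: "nat \<Rightarrow> nat" where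
    "(\<forall>i j. i < j \<longrightarrow> s (\<phi> i) \<sqsubset> s (\<phi> j)) \<or> (\<forall>i j. i < j \<longrightarrow> s (\<phi> j) \<sqsubset> s (\<phi> i))"
    using monotone_subsequence[OF s] by blast
  then show ?thesis
  proof
    assume "\<forall>i j. i < j \<longrightarrow> s (\<phi> j) \<sqsubset> s (\<phi> i)"
    then interpret decreasing_sequence V r "\<lambda>i. s (\<phi> i)"
      by unfold_locales blast
    show ?thesis using embeds_P1_or_P2[OF assms(1)] by blast
  next
    assume "\<forall>i j. i < j \<longrightarrow> s (\<phi> i) \<sqsubset> s (\<phi> j)"
    \<comment> \<open>The increasing sequence decreases in the dual; transferring back inverts each
      of the embedded posets.\<close>
    then interpret dual: decreasing_sequence V "r\<inverse>" "\<lambda>i. s (\<phi> i)"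
      by unfold_locales (simp add: slt_def, metis)
    show ?thesis
      using dual.embeds_P1_or_P2 assms(1) by (auto simp: prime_poset_converse embeds_poset_converse)
  qed
qed

end
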